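(* Let $(X,d)$ be a Ptolemy space. Then $\Theta:(0,\infty)^3\to(0,\infty)$ defined by $$\Theta(\varepsilon,a,b):=\sqrt{b^2+a\varepsilon}-b$$ is a modulus of uniform betweenness for $X$.
   Context: A metric space $(X,d)$ is a Ptolemy space if $d(x,z)\,d(y,w)\le d(x,y)\,d(z,w)+d(x,w)\,d(y,z)$ for all $x,y,z,w\in X$. A function $\Theta:(0,\infty)^3\to(0,\infty)$ is a modulus of uniform betweenness for a metric space $(X,d)$ if for all $\varepsilon,a,b>0$, writing $\theta=\Theta(\varepsilon,a,b)$, and all $x,y,z,w\in X$: if $\operatorname{sep}\{x,y,z,w\}\ge a$, $\operatorname{diam}\{x,y,z,w\}\le b$, $d(x,y)+d(y,z)\le d(x,z)+\theta$ and $d(y,z)+d(z,w)\le d(y,w)+\theta$, then $d(x,z)+d(z,w)\le d(x,w)+\varepsilon$. Here $\operatorname{diam}\{x,y,z,w\}$ is the largest of the pairwise distances, and $\operatorname{sep}\{x,y,z,w\}\ge a$ means that the four points are pairwise distinct and all six pairwise distances are $\ge a$. *)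

theory Defs
  imports "HOL-Analysis.Analysis"
begin

locale Ptolemy_space = Metric_space +
  assumes ptolemy:
    "\<lbrakk>x \<in> M; y \<in> M; z \<in> M; w \<in> M\<rbrakk>
      \<Longrightarrow> d x z * d y w \<le> d x y * d z w + d x w * d y z"

context Metric_space
begin

text \<open>Intended for finite nonempty \<open>S\<close>, where the diameter is a maximum.\<close>

definition finite_diam :: "'a set \<Rightarrow> real" where
  "finite_diam S = Max ((\<lambda>(u, v). d u v) ` (S \<times> S))"

text \<open>The points are passed as a list because \<open>sep{x,y,z,w} \<ge> a\<close> includes that the listed points
  are pairwise distinct, which the set \<open>{x,y,z,w}\<close> does not record.\<close>

definition sep_ge :: "'a list \<Rightarrow> real \<Rightarrow> bool" where
  "sep_ge ps a \<longleftrightarrow>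
     distinct ps \<and> (\<forall>u \<in> set ps. \<forall>v \<in> set ps. u \<noteq> v \<longrightarrow> a \<le> d u v)"

text \<open>\<open>\<Theta>\<close> is a total function here; only its values at positive arguments matter, and the first
  conjunct says that these are positive.\<close>

definition modulus_of_uniform_betweenness :: "(real \<Rightarrow> real \<Rightarrow> real \<Rightarrow> real) \<Rightarrow> bool" where
  "modulus_of_uniform_betweenness \<Theta> \<longleftrightarrow>
     (\<forall>\<epsilon> > 0. \<forall>a > 0. \<forall>b > 0. \<Theta> \<epsilon> a b > 0) \<and>
     (\<forall>\<epsilon> > 0. \<forall>a > 0. \<forall>b > 0. \<forall>x \<in> M. \<forall>y \<in> M. \<forall>z \<in> M. \<forall>w \<in> M.
        sep_ge [x, y, z, w] a \<and>
        finite_diam {x, y, z, w} \<le> b \<and>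
        d x y + d y z \<le> d x z + \<Theta> \<epsilon> a b \<and>
        d y z + d z w \<le> d y w + \<Theta> \<epsilon> a b
        \<longrightarrow> d x z + d z w \<le> d x w + \<epsilon>)"

end

end

theory Submission
  imports Defs
begin

text \<open>Write \<open>\<theta>\<close> for the modulus. Ptolemy's inequality and the two hypotheses give
  \<open>d(y,z) (d(x,z) + d(z,w) - d(x,w)) \<le> d(x,z) (d(y,z) - d(y,w)) + d(z,w) (d(x,y) + d(y,z))
   \<le> \<theta> (d(x,z) + d(z,w)) \<le> 2b\<theta>\<close>,
  and \<open>\<theta>\<close> is the positive root of \<open>\<theta>\<^sup>2 + 2b\<theta> = a\<epsilon>\<close>, so the right-hand side is at most
  \<open>a\<epsilon> \<le> d(y,z) \<epsilon>\<close>.\<close>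

lemma (in Metric_space) dist_le_finite_diam:
  assumes "finite S" "u \<in> S" "v \<in> S"
  shows "d u v \<le> finite_diam S"
  unfolding finite_diam_def using assms by (intro Max_ge) (auto intro: image_eqI[of _ _ "(u, v)"])

lemma (in Ptolemy_space) ptolemy_betweenness:
  assumes M: "x \<in> M" "y \<in> M" "z \<in> M" "w \<in> M"
    and xyz: "d x y + d y z \<le> d x z + \<theta>"
    and yzw: "d y z + d z w \<le> d y w + \<theta>"
  shows "d y z * (d x z + d z w - d x w) \<le> \<theta> * (d x z + d z w)"
proof -
  \<comment> \<open>The weights \<open>d x z\<close> and \<open>d z w\<close> produce the terms
    \<open>d x z * d y w\<close> and \<open>d x y * d z w\<close> of Ptolemy's inequality. On
    adding, \<open>d x z * d z w\<close> occurs on both sides and cancels.\<close>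
  have "d x z * (d y z + d z w) \<le> d x z * (d y w + \<theta>)"
    using yzw by (intro mult_left_mono) auto
  moreover have "d z w * (d x y + d y z) \<le> d z w * (d x z + \<theta>)"
    using xyz by (intro mult_left_mono) auto
  ultimately show ?thesis
    using ptolemy[OF M] by (simp add: algebra_simps)
qed

lemma (in Ptolemy_space) modulus_of_uniform_betweenness_sqrt:
  "modulus_of_uniform_betweenness (\<lambda>\<epsilon> a b. sqrt (b\<^sup>2 + a * \<epsilon>) - b)"
  unfolding modulus_of_uniform_betweenness_def
proof (intro conjI allI impI ballI)
  fix \<epsilon> a b :: real
  assume pos: "\<epsilon> > 0" "a > 0" "b > 0"
  then show \<theta>_pos: "sqrt (b\<^sup>2 + a * \<epsilon>) - b > 0"
    by (simp add: real_less_rsqrt)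
  fix x y z w
  assume M: "x \<in> M" "y \<in> M" "z \<in> M" "w \<in> M"
  define \<theta> where "\<theta> = sqrt (b\<^sup>2 + a * \<epsilon>) - b"
  assume "sep_ge [x, y, z, w] a \<and> finite_diam {x, y, z, w} \<le> b \<and>
    d x y + d y z \<le> d x z + (sqrt (b\<^sup>2 + a * \<epsilon>) - b) \<and>
    d y z + d z w \<le> d y w + (sqrt (b\<^sup>2 + a * \<epsilon>) - b)"
  then have sep: "sep_ge [x, y, z, w] a" and diam: "finite_diam {x, y, z, w} \<le> b"
    and xyz: "d x y + d y z \<le> d x z + \<theta>" and yzw: "d y z + d z w \<le> d y w + \<theta>"
    by (auto simp: \<theta>_def)
  \<comment> \<open>Distinctness of the listed points supplies \<open>y \<noteq> z\<close>, without
    which \<open>sep_ge\<close> bounds nothing here.\<close>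
  have a_le: "a \<le> d y z"
    using sep by (auto simp: sep_ge_def)
  have "d x z \<le> b" "d z w \<le> b"
    using dist_le_finite_diam[of "{x, y, z, w}" x z] dist_le_finite_diam[of "{x, y, z, w}" z w] diam
    by simp_all
  moreover have "\<theta> > 0"
    using \<theta>_pos by (simp add: \<theta>_def)
  ultimately have "\<theta> * (d x z + d z w) \<le> \<theta> * (2 * b)"
    by (intro mult_left_mono) auto
  \<comment> \<open>Adding \<open>\<theta>\<^sup>2\<close> completes the square, and
    \<open>\<theta> + b\<close> is exactly the square root in the modulus.\<close>
  also have "\<dots> \<le> \<theta>\<^sup>2 + 2 * b * \<theta>"
    by simp
  also have "\<dots> = (\<theta> + b)\<^sup>2 - b\<^sup>2"
    by (simp add: power2_eq_square algebra_simps)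
  also have "\<dots> = a * \<epsilon>"
    using pos by (simp add: \<theta>_def)
  also have "\<dots> \<le> d y z * \<epsilon>"
    using a_le pos by simp
  finally have "d y z * (d x z + d z w - d x w) \<le> d y z * \<epsilon>"
    using ptolemy_betweenness[OF M xyz yzw] by linarith
  \<comment> \<open>The common factor \<open>d y z\<close> cancels, being at least
    \<open>a > 0\<close>.\<close>
  then show "d x z + d z w \<le> d x w + \<epsilon>"
    using a_le pos by simp
qed

theorem proposition4p2:
  fixes X :: "'a set" and d :: "'a \<Rightarrow> 'a \<Rightarrow> real"
  assumes "Ptolemy_space X d"
  shows "Metric_space.modulus_of_uniform_betweenness X d (\<lambda>\<epsilon> a b. sqrt (b\<^sup>2 + a * \<epsilon>) - b)"
  using assms by (rule Ptolemy_space.modulus_of_uniform_betweenness_sqrt)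

end
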